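(* Let $\tau,\sigma\in\mathbb{N}\cup\{0\}$ with $\tau>\sigma$, let $a,b,q:\mathbb{N}\to\mathbb{R}$ and $r:\mathbb{N}\to\mathbb{R}\setminus\{0\}$ be sequences, and let $f:\mathbb{R}\to\mathbb{R}$ be a function. Assume that: (i) $f$ is locally Lipschitz and bounded with constant $P$, i.e. $|f(u)|\le P$ for all $u\in\mathbb{R}$; (ii) there exist $C\in(0,1)$ and an increasing sequence $(w_k)_{k\in\mathbb{N}}\subset(0,1)$ with $\sum_{k=1}^{\infty}(1-w_k)<\infty$ such that, as $k\to\infty$, $$\sum_{s=k}^{\infty}\left|\frac{1}{r_s}\right|\sum_{t=s}^{\infty}\left(|a_t|P+|b_t|\right)\in O\left((1-w_k)(Cw_k)^k\right);$$ (iii) $q_n\in(0,1)$ for all $n\in\mathbb{N}$, $\lim_{n\to\infty}q_n=1$, and $\inf_{n\in\mathbb{N}}q_n>0$. Then there exists a bounded full solution to the equation $$\Delta\left(r_n\Delta\left(x_n+q_nx_{n-\tau}\right)\right)=a_nf(x_{n-\sigma})+b_n.$$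
   Context: $\mathbb{N}=\{1,2,3,\dots\}$, and $\Delta$ is the forward difference operator, $\Delta y_n=y_{n+1}-y_n$. Sums of nonnegative terms are understood in $[0,\infty]$. For sequences $u_k\ge 0$, $v_k>0$, the relation $u_k\in O(v_k)$ means that there are $D>0$ and $k_0\in\mathbb{N}$ with $u_k\le D v_k$ for all $k\ge k_0$. A full solution of the equation is a real sequence $x=(x_n)_{n\ge 0}$ such that the equation holds for every integer $n\ge\max\{\tau,\sigma\}$ (here $\max\{\tau,\sigma\}=\tau\ge1$). It is bounded if $\sup_n|x_n|<\infty$. *)

theory Defs
  imports "HOL-Analysis.Analysis"
begin

text \<open>
  Sequences indexed by the positive integers are functions on \<^typ>\<open>nat\<close> whose value at 0 is never
  used; the unknown sequence \<open>x\<close> is indexed from 0.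
\<close>

definition forward_diff :: "(nat \<Rightarrow> real) \<Rightarrow> nat \<Rightarrow> real" where
  "forward_diff y n = y (n + 1) - y n"

text \<open>
  The truncated subtractions below are exact, because \<open>n \<ge> max \<tau> \<sigma>\<close>.
\<close>

definition full_solution ::
  "nat \<Rightarrow> nat \<Rightarrow> (nat \<Rightarrow> real) \<Rightarrow> (nat \<Rightarrow> real) \<Rightarrow> (nat \<Rightarrow> real) \<Rightarrow> (nat \<Rightarrow> real)
    \<Rightarrow> (real \<Rightarrow> real) \<Rightarrow> (nat \<Rightarrow> real) \<Rightarrow> bool" where
  "full_solution \<tau> \<sigma> a b q r f x \<longleftrightarrow>
    (\<forall>n \<ge> max \<tau> \<sigma>.
      forward_diff (\<lambda>m. r m * forward_diff (\<lambda>k. x k + q k * x (k - \<tau>)) m) n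
        = a n * f (x (n - \<sigma>)) + b n)"

text \<open>
  The left-hand sequence takes values in \<open>[0,\<infinity>]\<close>, so the Landau symbols of the library, which need a
  normed field, do not apply.
\<close>

definition ennreal_bigo :: "(nat \<Rightarrow> ennreal) \<Rightarrow> (nat \<Rightarrow> real) \<Rightarrow> bool" where
  "ennreal_bigo u v \<longleftrightarrow> (\<exists>D>0. \<exists>k0\<ge>1. \<forall>k\<ge>k0. u k \<le> ennreal (D * v k))"

end

theory Submission
  imports Defs
begin

text \<open>
  Write \<open>F\<^sub>x(t) = a\<^sub>t f(x\<^sub>t\<^sub>-\<^sub>\<sigma>) + b\<^sub>t\<close> for the right-hand side. The iterated tail sum
  \<open>g\<^sub>x(n) = \<Sum>\<^sub>s\<^sub>\<ge>\<^sub>n 1/r\<^sub>s \<Sum>\<^sub>t\<^sub>\<ge>\<^sub>s F\<^sub>x(t)\<close> satisfies \<open>\<Delta>(r\<^sub>n \<Delta> g\<^sub>x(n)) = F\<^sub>x(n)\<close>, so a sequence with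
  \<open>x\<^sub>n + q\<^sub>n x\<^sub>n\<^sub>-\<^sub>\<tau> = g\<^sub>x(n)\<close> solves the equation. Since \<open>f\<close> is bounded by \<open>P\<close>, condition (ii) bounds
  \<open>g\<^sub>x(n)\<close> by \<open>D C\<^sup>n\<close> for large \<open>n\<close>, uniformly in \<open>x\<close>.

  Solving the neutral equation for the delayed term gives \<open>x\<^sub>n = (g\<^sub>x(n+\<tau>) - x\<^sub>n\<^sub>+\<^sub>\<tau>) / q\<^sub>n\<^sub>+\<^sub>\<tau>\<close>. The
  coefficient \<open>1 / q\<^sub>n\<^sub>+\<^sub>\<tau>\<close> exceeds 1, which rules out a contraction estimate in the supremum norm. The exponential decay of \<open>g\<^sub>x\<close>
  makes it possible to look for a decaying solution \<open>x\<^sub>n = C\<^sup>n y\<^sub>n\<close> with \<open>y\<close> bounded, and in terms of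
  \<open>y\<close> the neutral term \<open>x\<^sub>n\<^sub>+\<^sub>\<tau> / q\<^sub>n\<^sub>+\<^sub>\<tau>\<close> acquires the factor \<open>C\<^sup>\<tau> / q\<^sub>n\<^sub>+\<^sub>\<tau>\<close>, whose limit \<open>C\<^sup>\<tau>\<close> is less
  than 1. As \<open>\<tau> > \<sigma>\<close>, the value \<open>g\<^sub>x(n+\<tau>)\<close> depends only on the \<open>x\<^sub>k\<close> with \<open>k > n\<close>, and the same
  scaling makes the Lipschitz constant of its contribution \<open>O(C\<^sup>n)\<close>. Hence for \<open>n \<ge> N\<close> with \<open>N\<close> large
  the map is a contraction of a ball of bounded sequences, and Banach's fixed point theorem gives a
  bounded sequence that solves the equation for all large \<open>n\<close> (lemma \<open>eventual_solution\<close>).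

  Finally, in the equation at index \<open>n\<close> the term \<open>x\<^sub>n\<^sub>-\<^sub>\<tau>\<close> has the smallest index and the
  coefficient \<open>r\<^sub>n q\<^sub>n \<noteq> 0\<close>. Once the equation holds for \<open>n \<ge> M\<close>, the ones at
  \<open>n = M-1, M-2, \<dots>, \<tau>\<close> can therefore be solved in turn by
  redefining one value each (lemma \<open>extend_solution_backwards\<close>), and finitely many changes preserve
  boundedness.
\<close>

section \<open>Iterated tail sums\<close>

definition iterated_tail :: "(nat \<Rightarrow> real) \<Rightarrow> (nat \<Rightarrow> real) \<Rightarrow> nat \<Rightarrow> real" where
  "iterated_tail r h m = (\<Sum>\<^sub>\<infinity>s\<in>{m..}. 1 / r s * (\<Sum>\<^sub>\<infinity>t\<in>{s..}. h t))"

lemma infsum_atLeast_rec: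
  fixes h :: "nat \<Rightarrow> real"
  assumes "h summable_on {m..}"
  shows "(\<Sum>\<^sub>\<infinity>t\<in>{m..}. h t) = h m + (\<Sum>\<^sub>\<infinity>t\<in>{Suc m..}. h t)"
proof -
  have "h summable_on {Suc m..}"
    by (rule summable_on_subset[OF assms]) auto
  moreover have "{m..} = insert m {Suc m..}"
    by auto
  ultimately show ?thesis
    by (simp add: infsum_insert)
qed

lemma majorised_infsum:
  fixes h g :: "'a \<Rightarrow> real"
  assumes "g summable_on S" and "\<And>x. x \<in> S \<Longrightarrow> \<bar>h x\<bar> \<le> g x"
  shows majorised_summable: "h summable_on S"
    and abs_infsum_le_majorant: "\<bar>infsum h S\<bar> \<le> infsum g S"
proof -
  show h: "h summable_on S"
    by (rule abs_summable_summable, rule Infinite_Sum.abs_summable_on_comparison_test'[OF assms(1)])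
      (use assms(2) in auto)
  show "\<bar>infsum h S\<bar> \<le> infsum g S"
    using norm_infsum_le[OF has_sum_infsum[OF h] has_sum_infsum[OF assms(1)]] assms(2) by simp
qed

text \<open>
  All forcing terms that occur are dominated by one nonnegative sequence \<open>A\<close>, and the locale collects
  what is needed to manipulate their iterated tail sums. Only tails from \<open>k0\<close> onwards are controlled,
  as in an asymptotic bound. Below, the tail sum formed with \<open>\<bar>r\<bar>\<close> and \<open>A\<close> serves as the bound for all
  others.
\<close>
locale iterated_majorant =
  fixes r A :: "nat \<Rightarrow> real" and k0 :: nat
  assumes majorant_nonneg: "\<And>t. 0 \<le> A t"
    and majorant_summable: "A summable_on {k0..}"
    and outer_summable: "(\<lambda>s. 1 / \<bar>r s\<bar> * (\<Sum>\<^sub>\<infinity>t\<in>{s..}. A t)) summable_on {k0..}"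
begin

lemma inner_majorised:
  assumes "k0 \<le> m" and "m \<le> s" and "\<And>t. m \<le> t \<Longrightarrow> \<bar>h t\<bar> \<le> c * A t"
  shows inner_summable: "h summable_on {s..}"
    and abs_inner_le: "\<bar>\<Sum>\<^sub>\<infinity>t\<in>{s..}. h t\<bar> \<le> c * (\<Sum>\<^sub>\<infinity>t\<in>{s..}. A t)"
proof -
  have "(\<lambda>t. c * A t) summable_on {s..}"
    by (rule summable_on_cmult_right, rule summable_on_subset[OF majorant_summable])
      (use assms in auto)
  moreover have "\<bar>h t\<bar> \<le> c * A t" if "t \<in> {s..}" for t
    using that assms by auto
  ultimately show "h summable_on {s..}" "\<bar>\<Sum>\<^sub>\<infinity>t\<in>{s..}. h t\<bar> \<le> c * (\<Sum>\<^sub>\<infinity>t\<in>{s..}. A t)"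
    using majorised_summable[of "\<lambda>t. c * A t" "{s..}" h]
      abs_infsum_le_majorant[of "\<lambda>t. c * A t" "{s..}" h]
    by (auto simp: infsum_cmult_right')
qed

lemma outer_majorised:
  assumes "k0 \<le> m" and "\<And>t. m \<le> t \<Longrightarrow> \<bar>h t\<bar> \<le> c * A t"
  shows iterated_summable: "(\<lambda>s. 1 / r s * (\<Sum>\<^sub>\<infinity>t\<in>{s..}. h t)) summable_on {m..}"
    and abs_iterated_tail_le: "\<bar>iterated_tail r h m\<bar> \<le> c * iterated_tail (\<lambda>s. \<bar>r s\<bar>) A m"
proof -
  define G where "G s = c * (1 / \<bar>r s\<bar> * (\<Sum>\<^sub>\<infinity>t\<in>{s..}. A t))" for s
  have 1: "G summable_on {m..}"
    unfolding G_def
    by (rule summable_on_cmult_right, rule summable_on_subset[OF outer_summable])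
      (use assms in auto)
  have 2: "\<bar>1 / r s * (\<Sum>\<^sub>\<infinity>t\<in>{s..}. h t)\<bar> \<le> G s" if "s \<in> {m..}" for s
  proof -
    have "\<bar>1 / r s * (\<Sum>\<^sub>\<infinity>t\<in>{s..}. h t)\<bar> = 1 / \<bar>r s\<bar> * \<bar>\<Sum>\<^sub>\<infinity>t\<in>{s..}. h t\<bar>"
      by (simp add: abs_mult)
    also have "\<dots> \<le> 1 / \<bar>r s\<bar> * (c * (\<Sum>\<^sub>\<infinity>t\<in>{s..}. A t))"
      by (rule mult_left_mono[OF abs_inner_le[of m]]) (use assms that in auto)
    finally show ?thesis
      by (simp add: G_def mult_ac)
  qed
  show "(\<lambda>s. 1 / r s * (\<Sum>\<^sub>\<infinity>t\<in>{s..}. h t)) summable_on {m..}"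
    by (rule majorised_summable[OF 1 2])
  have "\<bar>iterated_tail r h m\<bar> \<le> infsum G {m..}"
    unfolding iterated_tail_def by (rule abs_infsum_le_majorant[OF 1 2])
  also have "\<dots> = c * iterated_tail (\<lambda>s. \<bar>r s\<bar>) A m"
    by (simp add: G_def[abs_def] iterated_tail_def infsum_cmult_right' del: times_divide_eq_left)
  finally show "\<bar>iterated_tail r h m\<bar> \<le> c * iterated_tail (\<lambda>s. \<bar>r s\<bar>) A m" .
qed

lemma iterated_tail_diff:
  assumes "k0 \<le> m" and "\<And>t. m \<le> t \<Longrightarrow> \<bar>h t\<bar> \<le> c * A t" and "\<And>t. m \<le> t \<Longrightarrow> \<bar>h' t\<bar> \<le> c' * A t"
  shows "iterated_tail r (\<lambda>t. h t - h' t) m = iterated_tail r h m - iterated_tail r h' m"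
proof -
  have inner: "(\<Sum>\<^sub>\<infinity>t\<in>{s..}. h t - h' t) = (\<Sum>\<^sub>\<infinity>t\<in>{s..}. h t) - (\<Sum>\<^sub>\<infinity>t\<in>{s..}. h' t)"
    if "s \<in> {m..}" for s
    using infsum_add[of h "{s..}" "\<lambda>t. - h' t"] inner_summable[of m s h c]
      inner_summable[of m s h' c'] assms that
    by (simp add: infsum_uminus summable_on_uminus)
  have "iterated_tail r (\<lambda>t. h t - h' t) m
      = (\<Sum>\<^sub>\<infinity>s\<in>{m..}. 1 / r s * (\<Sum>\<^sub>\<infinity>t\<in>{s..}. h t) + - (1 / r s * (\<Sum>\<^sub>\<infinity>t\<in>{s..}. h' t)))"
    unfolding iterated_tail_def by (rule infsum_cong) (simp add: inner diff_divide_distrib)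
  also have "\<dots> = iterated_tail r h m - iterated_tail r h' m"
    unfolding iterated_tail_def
    by (subst infsum_add)
      (use iterated_summable[OF assms(1,2)] iterated_summable[OF assms(1,3)] in
        \<open>simp_all add: infsum_uminus summable_on_uminus\<close>)
  finally show ?thesis .
qed

text \<open>
  A tail sum decreases by its first term, once for each of the two nested sums: the iterated tail is
  a right inverse of the operator \<open>\<Delta>(r \<Delta>)\<close>. The two minus signs cancel.
\<close>
lemma iterated_tail_solves:
  assumes "k0 \<le> m" and "\<And>t. m \<le> t \<Longrightarrow> \<bar>h t\<bar> \<le> c * A t" and "\<And>t. m \<le> t \<Longrightarrow> r t \<noteq> 0"
  shows "forward_diff (\<lambda>k. r k * forward_diff (iterated_tail r h) k) m = h m"
proof -
  have step: "r k * forward_diff (iterated_tail r h) k = - (\<Sum>\<^sub>\<infinity>t\<in>{k..}. h t)" if "m \<le> k" for k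
    using infsum_atLeast_rec[OF iterated_summable[of k h c]] assms that
    by (simp add: forward_diff_def iterated_tail_def)
  show ?thesis
    using infsum_atLeast_rec[OF inner_summable[of m m h c]] assms step[of m] step[of "m + 1"]
    unfolding forward_diff_def[of _ m]
    by simp
qed

end

section \<open>From extended to real sums\<close>

lemma real_infsum_le_of_ennreal:
  fixes f :: "'a \<Rightarrow> real"
  assumes "\<And>x. x \<in> S \<Longrightarrow> 0 \<le> f x" and "0 \<le> M"
    and "(\<Sum>\<^sub>\<infinity>x\<in>S. ennreal (f x)) \<le> ennreal M"
  shows "f summable_on S" and "infsum f S \<le> M"
proof -
  have fin: "sum f F \<le> M" if "finite F" "F \<subseteq> S" for F
  proof -
    have "ennreal (sum f F) = (\<Sum>\<^sub>\<infinity>x\<in>F. ennreal (f x))"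
      using that assms(1) by (subst sum_ennreal[symmetric]) auto
    also have "\<dots> \<le> (\<Sum>\<^sub>\<infinity>x\<in>S. ennreal (f x))"
      using that by (intro infsum_mono_neutral nonneg_summable_on_complete) auto
    also note assms(3)
    finally show ?thesis
      using assms(2) by simp
  qed
  show "f summable_on S"
    by (rule nonneg_bdd_above_summable_on) (use assms(1) fin in \<open>auto simp: bdd_above_def\<close>)
  then show "infsum f S \<le> M"
    by (rule infsum_le_finite_sums) (use fin in auto)
qed

text \<open>
  Finiteness of the outer sum forces finiteness of each inner sum only because the weight \<open>\<bar>1 / r s\<bar>\<close>
  is nonzero, in view of \<open>0 \<cdot> \<infinity> = 0\<close>.
\<close>
lemma iterated_majorant_of_ennreal:
  assumes A: "\<And>t. 0 \<le> A t" and r: "\<And>s. k0 \<le> s \<Longrightarrow> r s \<noteq> 0" and M: "\<And>k. 0 \<le> M k"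
    and le: "\<And>k. k0 \<le> k \<Longrightarrow>
      (\<Sum>\<^sub>\<infinity>s\<in>{k..}. ennreal \<bar>1 / r s\<bar> * (\<Sum>\<^sub>\<infinity>t\<in>{s..}. ennreal (A t))) \<le> ennreal (M k)"
  shows "iterated_majorant r A k0"
    and "\<And>k. k0 \<le> k \<Longrightarrow> iterated_tail (\<lambda>s. \<bar>r s\<bar>) A k \<le> M k"
proof -
  define I where "I s = (\<Sum>\<^sub>\<infinity>t\<in>{s..}. ennreal (A t))" for s
  have I_finite: "I s < top" if s: "k0 \<le> s" for s
  proof -
    have "ennreal \<bar>1 / r s\<bar> * I s = (\<Sum>\<^sub>\<infinity>s\<in>{s}. ennreal \<bar>1 / r s\<bar> * I s)"
      by simp
    also have "\<dots> \<le> (\<Sum>\<^sub>\<infinity>s\<in>{s..}. ennreal \<bar>1 / r s\<bar> * I s)"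
      by (intro infsum_mono_neutral nonneg_summable_on_complete) auto
    also have "\<dots> \<le> ennreal (M s)"
      using le[OF s] by (simp add: I_def)
    finally have "ennreal \<bar>1 / r s\<bar> * I s < top"
      by (simp add: le_less_trans)
    then show ?thesis
      using r[OF s] by (auto simp: ennreal_mult_less_top)
  qed
  have inner: "A summable_on {s..}" "ennreal (infsum A {s..}) \<le> I s" if s: "k0 \<le> s" for s
  proof -
    have e: "ennreal (enn2real (I s)) = I s"
      using I_finite[OF s] by simp
    then have "(\<Sum>\<^sub>\<infinity>t\<in>{s..}. ennreal (A t)) \<le> ennreal (enn2real (I s))"
      by (simp add: I_def)
    note * = real_infsum_le_of_ennreal[OF A enn2real_nonneg this]
    show "A summable_on {s..}"
      by (rule *(1))
    show "ennreal (infsum A {s..}) \<le> I s"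
      using ennreal_leI[OF *(2)] e by simp
  qed
  have nonneg: "0 \<le> 1 / \<bar>r s\<bar> * infsum A {s..}" for s
    by (intro mult_nonneg_nonneg infsum_nonneg) (use A in auto)
  have outer: "(\<Sum>\<^sub>\<infinity>s\<in>{k..}. ennreal (1 / \<bar>r s\<bar> * infsum A {s..})) \<le> ennreal (M k)"
    if k: "k0 \<le> k" for k
  proof -
    have "(\<Sum>\<^sub>\<infinity>s\<in>{k..}. ennreal (1 / \<bar>r s\<bar> * infsum A {s..}))
        \<le> (\<Sum>\<^sub>\<infinity>s\<in>{k..}. ennreal \<bar>1 / r s\<bar> * I s)"
    proof (intro infsum_mono nonneg_summable_on_complete)
      fix s assume "s \<in> {k..}"
      then have "k0 \<le> s"
        using k by auto
      have "ennreal (1 / \<bar>r s\<bar> * infsum A {s..}) = ennreal \<bar>1 / r s\<bar> * ennreal (infsum A {s..})"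
        using A by (subst ennreal_mult[symmetric]) (auto intro!: infsum_nonneg)
      also have "\<dots> \<le> ennreal \<bar>1 / r s\<bar> * I s"
        by (intro mult_left_mono inner(2)) (use \<open>k0 \<le> s\<close> in auto)
      finally show "ennreal (1 / \<bar>r s\<bar> * infsum A {s..}) \<le> ennreal \<bar>1 / r s\<bar> * I s" .
    qed auto
    also have "\<dots> \<le> ennreal (M k)"
      using le[OF k] by (simp add: I_def)
    finally show ?thesis .
  qed
  note outer_real = real_infsum_le_of_ennreal[OF nonneg M outer]
  show "iterated_majorant r A k0"
    by unfold_locales (use A inner(1) outer_real(1) in auto)
  show "iterated_tail (\<lambda>s. \<bar>r s\<bar>) A k \<le> M k" if "k0 \<le> k" for k
    using outer_real(2)[OF that] by (simp add: iterated_tail_def)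
qed

section \<open>Contraction\<close>

text \<open>
  A Cauchy sequence for the supremum distance is uniformly Cauchy, and its uniform limit is again
  bounded; continuity is no constraint on the discrete index space \<open>nat\<close>.
\<close>
lemma complete_bounded_sequences: "complete (UNIV :: (nat \<Rightarrow>\<^sub>C real) set)"
proof (rule completeI)
  fix F :: "nat \<Rightarrow> (nat \<Rightarrow>\<^sub>C real)"
  assume "Cauchy F"
  have "uniformly_Cauchy_on UNIV (\<lambda>n. apply_bcontfun (F n))"
  proof (rule uniformly_Cauchy_onI)
    fix e :: real
    assume "0 < e"
    with \<open>Cauchy F\<close> obtain M where "\<And>m n. \<lbrakk>M \<le> m; M \<le> n\<rbrakk> \<Longrightarrow> dist (F m) (F n) < e"
      unfolding Cauchy_def by blast
    then show "\<exists>M. \<forall>x\<in>UNIV. \<forall>m\<ge>M. \<forall>n\<ge>M. dist (F m x) (F n x) < e"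
      using dist_fun_lt_imp_dist_val_lt by blast
  qed
  then obtain g where "uniform_limit UNIV (\<lambda>n. apply_bcontfun (F n)) g sequentially"
    using Cauchy_uniformly_convergent uniformly_convergent_on_def by blast
  then obtain l where "F \<longlonglongrightarrow> l"
    by (rule uniform_limit_bcontfunE[OF _ sequentially_bot])
  then show "\<exists>l\<in>UNIV. F \<longlonglongrightarrow> l"
    by blast
qed

text \<open>
  The factor \<open>P\<close> is extracted because the decay hypothesis controls \<open>\<bar>a\<^sub>t\<bar> P\<close> rather than \<open>\<bar>a\<^sub>t\<bar>\<close>; when
  \<open>P = 0\<close> the function vanishes and there is nothing to control.
\<close>
lemma lipschitz_relative_to_bound:
  fixes f :: "real \<Rightarrow> real"
  assumes "local_lipschitz (UNIV :: real set) UNIV (\<lambda>_. f)" and "\<And>u. \<bar>f u\<bar> \<le> P"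
  obtains K where "0 \<le> K"
    and "\<And>u v. \<lbrakk>\<bar>u\<bar> \<le> R; \<bar>v\<bar> \<le> R\<rbrakk> \<Longrightarrow> \<bar>f u - f v\<bar> \<le> K * P * \<bar>u - v\<bar>"
proof (cases "P = 0")
  case True
  then show ?thesis
    using assms(2) by (intro that[of 0]) auto
next
  case False
  then have P: "0 < P"
    using assms(2)[of 0] by linarith
  have "local_lipschitz {0::real} {- R..R} (\<lambda>_. f)"
    by (rule local_lipschitz_subset[OF assms(1)]) auto
  then obtain L where "\<And>t. t \<in> {0::real} \<Longrightarrow> L-lipschitz_on {- R..R} f"
    by (rule local_lipschitz_compact_implies_lipschitz) auto
  then have L: "L-lipschitz_on {- R..R} f"
    by simp
  show ?thesis
  proof (rule that[of "L / P"])
    show "0 \<le> L / P"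
      using lipschitz_on_nonneg[OF L] P by simp
    show "\<bar>f u - f v\<bar> \<le> L / P * P * \<bar>u - v\<bar>" if "\<bar>u\<bar> \<le> R" "\<bar>v\<bar> \<le> R" for u v
      using lipschitz_onD[OF L, of u v] that P by (simp add: dist_real_def abs_le_iff)
  qed
qed

definition forcing ::
  "nat \<Rightarrow> (nat \<Rightarrow> real) \<Rightarrow> (nat \<Rightarrow> real) \<Rightarrow> (real \<Rightarrow> real) \<Rightarrow> (nat \<Rightarrow> real) \<Rightarrow> nat \<Rightarrow> real" where
  "forcing \<sigma> a b f x t = a t * f (x (t - \<sigma>)) + b t"

lemma abs_forcing_le:
  assumes "\<And>u. \<bar>f u\<bar> \<le> P"
  shows "\<bar>forcing \<sigma> a b f x t\<bar> \<le> \<bar>a t\<bar> * P + \<bar>b t\<bar>"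
proof -
  have "\<bar>forcing \<sigma> a b f x t\<bar> \<le> \<bar>a t\<bar> * \<bar>f (x (t - \<sigma>))\<bar> + \<bar>b t\<bar>"
    unfolding forcing_def abs_mult[symmetric] by (rule abs_triangle_ineq)
  also have "\<dots> \<le> \<bar>a t\<bar> * P + \<bar>b t\<bar>"
    by (intro add_right_mono mult_left_mono assms) auto
  finally show ?thesis .
qed

text \<open>
  The fixed point argument in the weighted coordinates \<open>y\<^sub>n = x\<^sub>n / C\<^sup>n\<close>. The map \<open>T\<close> is set to 0 below the
  threshold \<open>N\<close>, where the estimates may fail; this is harmless, since the equation
  at \<open>n \<ge> N + \<tau>\<close> does not involve the values of \<open>x\<close> below \<open>N\<close>.
\<close>
lemma eventual_solution:
  fixes a b q r :: "nat \<Rightarrow> real" and f :: "real \<Rightarrow> real" and P C D :: real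
  assumes "\<sigma> < \<tau>"
    and lip: "local_lipschitz (UNIV :: real set) UNIV (\<lambda>_. f)"
    and P: "\<And>u. \<bar>f u\<bar> \<le> P"
    and C: "0 < C" "C < 1"
    and q: "q \<longlonglongrightarrow> 1"
    and maj: "iterated_majorant r (\<lambda>t. \<bar>a t\<bar> * P + \<bar>b t\<bar>) k0"
    and D: "0 < D"
    and decay: "\<And>k. k0 \<le> k \<Longrightarrow>
      iterated_tail (\<lambda>s. \<bar>r s\<bar>) (\<lambda>t. \<bar>a t\<bar> * P + \<bar>b t\<bar>) k \<le> D * C ^ k"
  obtains x N where "bounded (range x)" and "k0 \<le> N"
    and "\<And>n. N \<le> n \<Longrightarrow> x n + q n * x (n - \<tau>) = iterated_tail r (forcing \<sigma> a b f x) n"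
proof -
  define A where "A t = \<bar>a t\<bar> * P + \<bar>b t\<bar>" for t
  interpret iterated_majorant r A k0
    using maj by (simp add: A_def[abs_def])
  have decay': "iterated_tail (\<lambda>s. \<bar>r s\<bar>) A k \<le> D * C ^ k" if "k0 \<le> k" for k
    using decay[OF that] by (simp add: A_def[abs_def])
  have C\<tau>: "0 < C ^ \<tau>" "C ^ \<tau> < 1"
    using C \<open>\<sigma> < \<tau>\<close> by (auto simp: power_less_one_iff)
  \<comment> \<open>Any number strictly between \<open>C ^ \<tau>\<close> and 1 would do: eventually \<open>q\<close> exceeds it.\<close>
  define \<theta> where "\<theta> = (1 + C ^ \<tau>) / 2"
  have \<theta>: "C ^ \<tau> < \<theta>" "\<theta> < 1" "0 < \<theta>"
    using C\<tau> by (auto simp: \<theta>_def)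
  \<comment> \<open>The radius that the a priori bound on \<open>T\<close> reproduces exactly, whatever the threshold \<open>N\<close>.
    This allows the Lipschitz constant of \<open>f\<close> on the ball to be fixed before \<open>N\<close> is chosen.\<close>
  define R where "R = D * C ^ \<tau> / (\<theta> - C ^ \<tau>)"
  have R: "0 \<le> R" "(D * C ^ \<tau> + C ^ \<tau> * R) / \<theta> = R"
    using D C\<tau> \<theta> by (auto simp: R_def field_simps)
  obtain K where K: "0 \<le> K"
    and K_lip: "\<And>u v. \<lbrakk>\<bar>u\<bar> \<le> R; \<bar>v\<bar> \<le> R\<rbrakk> \<Longrightarrow> \<bar>f u - f v\<bar> \<le> K * P * \<bar>u - v\<bar>"
    using lipschitz_relative_to_bound[OF lip P, of R] by blast
  have "(\<lambda>n. K * C ^ n * D * C ^ \<tau> + C ^ \<tau>) \<longlonglongrightarrow> K * 0 * D * C ^ \<tau> + C ^ \<tau>"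
    by (intro tendsto_intros LIMSEQ_power_zero) (use C in auto)
  then have "\<forall>\<^sub>F n in sequentially. K * C ^ n * D * C ^ \<tau> + C ^ \<tau> < \<theta>"
    by (rule order_tendstoD) (use \<theta> in auto)
  moreover have "\<forall>\<^sub>F n in sequentially. \<theta> < q n"
    using q \<theta>(2) by (rule order_tendstoD)
  ultimately have "\<forall>\<^sub>F n in sequentially. K * C ^ n * D * C ^ \<tau> + C ^ \<tau> < \<theta> \<and> \<theta> < q n \<and> k0 \<le> n"
    using eventually_ge_at_top[of k0] by eventually_elim auto
  then obtain N where N: "\<And>n. N \<le> n \<Longrightarrow> K * C ^ n * D * C ^ \<tau> + C ^ \<tau> < \<theta> \<and> \<theta> < q n \<and> k0 \<le> n"
    unfolding eventually_sequentially by blast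
  define scaled where "scaled y n = C ^ n * y n" for y :: "nat \<Rightarrow> real" and n
  define g where "g y = iterated_tail r (forcing \<sigma> a b f (scaled y))" for y
  define T where "T y n = (if n < N then 0 else (g y (n + \<tau>) / C ^ n - C ^ \<tau> * y (n + \<tau>)) / q (n + \<tau>))"
    for y n
  have forcing_le: "\<bar>forcing \<sigma> a b f x t\<bar> \<le> 1 * A t" for x t
    using abs_forcing_le[OF P] by (simp add: A_def)
  have scaled_le: "\<bar>scaled y n\<bar> \<le> R" if "\<And>n. \<bar>y n\<bar> \<le> R" for y n
  proof -
    have "\<bar>scaled y n\<bar> \<le> 1 * \<bar>y n\<bar>"
      unfolding scaled_def abs_mult using C by (intro mult_right_mono) (auto intro: power_le_one)
    with that[of n] show ?thesis by simp
  qed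
  have T_le: "\<bar>T y n\<bar> \<le> R" if y: "\<And>n. \<bar>y n\<bar> \<le> R" for y n
  proof (cases "n < N")
    case False
    then have n: "N \<le> n + \<tau>" by simp
    have "\<bar>g y (n + \<tau>)\<bar> \<le> 1 * iterated_tail (\<lambda>s. \<bar>r s\<bar>) A (n + \<tau>)"
      unfolding g_def by (rule abs_iterated_tail_le[OF _ forcing_le]) (use N[OF n] in auto)
    also have "\<dots> \<le> D * C ^ (n + \<tau>)"
      using decay'[of "n + \<tau>"] N[OF n] by simp
    finally have "\<bar>g y (n + \<tau>) / C ^ n\<bar> \<le> D * C ^ \<tau>"
      using C by (simp add: power_add field_simps)
    moreover have "\<bar>C ^ \<tau> * y (n + \<tau>)\<bar> \<le> C ^ \<tau> * R"
      using C\<tau> y[of "n + \<tau>"] by (simp add: abs_mult)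
    ultimately have "\<bar>g y (n + \<tau>) / C ^ n - C ^ \<tau> * y (n + \<tau>)\<bar> \<le> D * C ^ \<tau> + C ^ \<tau> * R"
      by linarith
    then have "\<bar>T y n\<bar> \<le> (D * C ^ \<tau> + C ^ \<tau> * R) / \<theta>"
      unfolding T_def using False N[OF n] \<theta>(3) by (auto simp: abs_divide intro!: frac_le)
    then show ?thesis
      using R(2) by simp
  qed (simp add: T_def R(1))
  define c where "c = (K * C ^ N * D * C ^ \<tau> + C ^ \<tau>) / \<theta>"
  have c: "0 \<le> c" "c < 1"
    using N[of N] K C D \<theta>(3) C\<tau> by (simp_all add: c_def)
  have T_contracts: "\<bar>T y n - T z n\<bar> \<le> c * d"
    if y: "\<And>n. \<bar>y n\<bar> \<le> R" and z: "\<And>n. \<bar>z n\<bar> \<le> R" and d: "\<And>n. \<bar>y n - z n\<bar> \<le> d" for y z n d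
  proof (cases "n < N")
    case True
    then show ?thesis
      using c(1) d[of 0] by (simp add: T_def)
  next
    case False
    have d0: "0 \<le> d"
      using d[of 0] by linarith
    from False have n: "N \<le> n + \<tau>" by simp
    have F: "\<bar>forcing \<sigma> a b f (scaled y) t - forcing \<sigma> a b f (scaled z) t\<bar> \<le> K * C ^ N * d * A t"
      if t: "n + \<tau> \<le> t" for t
    proof -
      \<comment> \<open>Here \<open>\<tau> > \<sigma>\<close> enters: only values of the sequences beyond the threshold contribute.\<close>
      have "N \<le> t - \<sigma>"
        using False t \<open>\<sigma> < \<tau>\<close> by simp
      have "\<bar>scaled y (t - \<sigma>) - scaled z (t - \<sigma>)\<bar> = C ^ (t - \<sigma>) * \<bar>y (t - \<sigma>) - z (t - \<sigma>)\<bar>"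
        using C by (simp add: scaled_def abs_mult flip: right_diff_distrib)
      also have "\<dots> \<le> C ^ N * d"
        using C d \<open>N \<le> t - \<sigma>\<close> by (intro mult_mono power_decreasing) auto
      finally have s: "\<bar>scaled y (t - \<sigma>) - scaled z (t - \<sigma>)\<bar> \<le> C ^ N * d" .
      have "\<bar>forcing \<sigma> a b f (scaled y) t - forcing \<sigma> a b f (scaled z) t\<bar>
          = \<bar>a t\<bar> * \<bar>f (scaled y (t - \<sigma>)) - f (scaled z (t - \<sigma>))\<bar>"
        by (simp add: forcing_def flip: abs_mult right_diff_distrib)
      also have "\<dots> \<le> \<bar>a t\<bar> * (K * P * (C ^ N * d))"
        using s K P[of 0]
        by (intro mult_left_mono order_trans[OF K_lip[OF scaled_le[OF y] scaled_le[OF z]]]) auto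
      also have "\<dots> \<le> K * C ^ N * d * A t"
        using K C d0 by (simp add: A_def algebra_simps)
      finally show ?thesis .
    qed
    have "\<bar>g y (n + \<tau>) - g z (n + \<tau>)\<bar>
        = \<bar>iterated_tail r (\<lambda>t. forcing \<sigma> a b f (scaled y) t - forcing \<sigma> a b f (scaled z) t) (n + \<tau>)\<bar>"
      unfolding g_def
      by (subst iterated_tail_diff[OF _ forcing_le forcing_le]) (use N[OF n] in auto)
    also have "\<dots> \<le> K * C ^ N * d * iterated_tail (\<lambda>s. \<bar>r s\<bar>) A (n + \<tau>)"
      by (rule abs_iterated_tail_le[OF _ F]) (use N[OF n] in auto)
    also have "\<dots> \<le> K * C ^ N * d * (D * C ^ (n + \<tau>))"
      using K C d0 N[OF n] by (intro mult_left_mono decay') auto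
    finally have "\<bar>(g y (n + \<tau>) - g z (n + \<tau>)) / C ^ n\<bar> \<le> K * C ^ N * d * (D * C ^ \<tau>)"
      using C by (simp add: power_add field_simps)
    moreover have "\<bar>C ^ \<tau> * (y (n + \<tau>) - z (n + \<tau>))\<bar> \<le> C ^ \<tau> * d"
      using C\<tau> d[of "n + \<tau>"] by (simp add: abs_mult)
    ultimately have "\<bar>(g y (n + \<tau>) - g z (n + \<tau>)) / C ^ n - C ^ \<tau> * (y (n + \<tau>) - z (n + \<tau>))\<bar>
        \<le> K * C ^ N * d * (D * C ^ \<tau>) + C ^ \<tau> * d"
      by linarith
    also have "\<dots> = (K * C ^ N * D * C ^ \<tau> + C ^ \<tau>) * d"
      by (simp add: algebra_simps)
    finally have "\<bar>(g y (n + \<tau>) - g z (n + \<tau>)) / C ^ n - C ^ \<tau> * (y (n + \<tau>) - z (n + \<tau>))\<bar>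
        \<le> (K * C ^ N * D * C ^ \<tau> + C ^ \<tau>) * d" .
    then have "\<bar>(g y (n + \<tau>) - g z (n + \<tau>)) / C ^ n - C ^ \<tau> * (y (n + \<tau>) - z (n + \<tau>))\<bar> / q (n + \<tau>)
        \<le> (K * C ^ N * D * C ^ \<tau> + C ^ \<tau>) * d / \<theta>"
      using N[OF n] \<theta>(3) by (intro frac_le) auto
    moreover have "T y n - T z n
        = ((g y (n + \<tau>) - g z (n + \<tau>)) / C ^ n - C ^ \<tau> * (y (n + \<tau>) - z (n + \<tau>))) / q (n + \<tau>)"
      using False by (simp add: T_def diff_divide_distrib right_diff_distrib)
    ultimately show ?thesis
      using N[OF n] \<theta>(3) by (simp add: c_def abs_divide)
  qed
  define TB :: "(nat \<Rightarrow>\<^sub>C real) \<Rightarrow> (nat \<Rightarrow>\<^sub>C real)" where "TB y = Bcontfun (T y)" for y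
  define S :: "(nat \<Rightarrow>\<^sub>C real) set" where "S = cball 0 R"
  have S_le: "\<bar>apply_bcontfun y n\<bar> \<le> R" if "y \<in> S" for y n
    using that norm_bounded[of y n] by (simp add: S_def)
  have TB_apply: "apply_bcontfun (TB y) n = T y n" if "y \<in> S" for y n
  proof -
    have "T y \<in> bcontfun"
      by (rule bcontfun_normI[of _ R]) (use T_le[OF S_le[OF that]] in auto)
    then show ?thesis
      by (simp add: TB_def Bcontfun_inverse)
  qed
  have "\<exists>!y. y \<in> S \<and> TB y = y"
  proof (rule Banach_fix[OF _ _ c])
    show "complete S"
      unfolding S_def
      by (rule complete_closed_subset[OF closed_cball subset_UNIV complete_bounded_sequences])
    show "S \<noteq> {}"
      using R(1) by (auto simp: S_def)
    show "TB ` S \<subseteq> S"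
    proof safe
      fix y assume y: "y \<in> S"
      have "dist (TB y) 0 \<le> R"
        by (rule dist_bound) (use T_le[OF S_le[OF y]] in \<open>simp add: TB_apply[OF y]\<close>)
      then show "TB y \<in> S"
        by (simp add: S_def)
    qed
    show "dist (TB y) (TB z) \<le> c * dist y z" if "y \<in> S" "z \<in> S" for y z
    proof (rule dist_bound)
      fix n
      show "dist (apply_bcontfun (TB y) n) (apply_bcontfun (TB z) n) \<le> c * dist y z"
        using T_contracts[OF S_le[OF that(1)] S_le[OF that(2)]
            dist_bounded[of y _ z, unfolded dist_real_def]]
        by (simp add: TB_apply that dist_real_def)
    qed
  qed
  then obtain y where y: "y \<in> S" "TB y = y"
    by blast
  have fixed: "T y n = y n" for n
    using TB_apply[OF y(1), of n] y(2) by simp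
  show thesis
  proof (rule that[of "scaled y" "N + \<tau>"])
    show "bounded (range (scaled y))"
      by (rule boundedI[of _ R]) (use scaled_le[OF S_le[OF y(1)]] in auto)
    show "k0 \<le> N + \<tau>"
      using N[of N] by simp
    show "scaled y n + q n * scaled y (n - \<tau>) = iterated_tail r (forcing \<sigma> a b f (scaled y)) n"
      if "N + \<tau> \<le> n" for n
    proof -
      define m where "m = n - \<tau>"
      then have n: "n = m + \<tau>" and m: "N \<le> m"
        using that by auto
      have "q n * y m = g y n / C ^ m - C ^ \<tau> * y n"
      proof -
        have "y m = (g y n / C ^ m - C ^ \<tau> * y n) / q n"
          using fixed[of m] m by (simp add: T_def n)
        moreover have "q n \<noteq> 0"
          using N[of n] \<theta>(3) n m by auto
        ultimately show ?thesis
          by simp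
      qed
      then have "C ^ m * (q n * y m) = g y n - C ^ n * y n"
        using C(1) by (simp add: right_diff_distrib) (simp add: n power_add)
      then show ?thesis
        by (simp add: scaled_def g_def n mult_ac)
    qed
  qed
qed

section \<open>Backward extension\<close>

text \<open>
  The equation at a single index, so that it can be established for one index at a time.
\<close>
definition solves_at ::
  "nat \<Rightarrow> nat \<Rightarrow> (nat \<Rightarrow> real) \<Rightarrow> (nat \<Rightarrow> real) \<Rightarrow> (nat \<Rightarrow> real) \<Rightarrow> (nat \<Rightarrow> real)
    \<Rightarrow> (real \<Rightarrow> real) \<Rightarrow> (nat \<Rightarrow> real) \<Rightarrow> nat \<Rightarrow> bool" where
  "solves_at \<tau> \<sigma> a b q r f x n \<longleftrightarrow>
    forward_diff (\<lambda>m. r m * forward_diff (\<lambda>k. x k + q k * x (k - \<tau>)) m) n = forcing \<sigma> a b f x n"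

text \<open>
  The value \<open>x k\<close> enters the equation at \<open>\<tau> + k\<close> only through \<open>q (\<tau> + k) * x k\<close>, and it does not
  enter the equations at larger indices. It can therefore be redefined to satisfy that equation
  without disturbing the ones that hold already.
\<close>
lemma extend_solution_backwards:
  assumes "\<sigma> < \<tau>" and r: "\<And>n. \<tau> \<le> n \<Longrightarrow> r n \<noteq> 0" and q: "\<And>n. \<tau> \<le> n \<Longrightarrow> q n \<noteq> 0"
    and "\<And>n. \<tau> + k \<le> n \<Longrightarrow> solves_at \<tau> \<sigma> a b q r f x n" and "bounded (range x)"
  shows "\<exists>x'. (\<forall>n\<ge>\<tau>. solves_at \<tau> \<sigma> a b q r f x' n) \<and> bounded (range x')"
  using assms(4,5)
proof (induction k arbitrary: x)
  case 0
  then show ?case by auto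
next
  case (Suc k)
  define M where "M = \<tau> + k"
  define z where "z n = x n + q n * x (n - \<tau>)" for n
  \<comment> \<open>The value that \<open>x M + q M * x k\<close> must take for the equation to hold at \<open>M\<close>.\<close>
  define zM where "zM = z (Suc M)
    - (r (Suc M) * (z (Suc (Suc M)) - z (Suc M)) - forcing \<sigma> a b f x M) / r M"
  define x' where "x' = x(k := (zM - x M) / q M)"
  have [simp]: "\<tau> \<noteq> 0"
    using \<open>\<sigma> < \<tau>\<close> by simp
  have z': "x' n + q n * x' (n - \<tau>) = (if n = M then zM else z n)" if "M \<le> n" for n
    using that q[of M] by (auto simp: x'_def z_def M_def)
  have forcing': "forcing \<sigma> a b f x' n = forcing \<sigma> a b f x n" if "M \<le> n" for n
    using that \<open>\<sigma> < \<tau>\<close> by (auto simp: x'_def forcing_def M_def)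
  have "solves_at \<tau> \<sigma> a b q r f x' n" if n: "M \<le> n" for n
  proof (cases "n = M")
    case True
    then show ?thesis
      using r[of M] by (simp add: solves_at_def forward_diff_def z' forcing' zM_def) (simp add: M_def)
  next
    case False
    then have "solves_at \<tau> \<sigma> a b q r f x n"
      using n by (intro Suc.prems(1)) (simp add: M_def)
    then show ?thesis
      using False n by (simp add: solves_at_def forward_diff_def z' forcing' z_def)
  qed
  moreover have "bounded (range x')"
  proof (rule bounded_subset)
    show "bounded (insert ((zM - x M) / q M) (range x))"
      using Suc.prems(2) by simp
  qed (auto simp: x'_def)
  ultimately show ?case
    by (intro Suc.IH) (auto simp: M_def)
qed

theorem theorem7:
  fixes \<tau> \<sigma> :: nat
    and a b q r w :: "nat \<Rightarrow> real"
    and f :: "real \<Rightarrow> real"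
    and P C :: real
  assumes "\<tau> > \<sigma>"
    and "\<And>n. n \<ge> 1 \<Longrightarrow> r n \<noteq> 0"
    and "local_lipschitz (UNIV :: real set) UNIV (\<lambda>_. f)"
    and "\<And>u. \<bar>f u\<bar> \<le> P"
    and "C \<in> {0<..<1}"
    and "mono_on {1..} w"
    and "\<And>k. k \<ge> 1 \<Longrightarrow> w k \<in> {0<..<1}"
    and "(\<lambda>k. 1 - w k) summable_on {1..}"
    and "ennreal_bigo
          (\<lambda>k. \<Sum>\<^sub>\<infinity>s\<in>{k..}. ennreal \<bar>1 / r s\<bar> * (\<Sum>\<^sub>\<infinity>t\<in>{s..}. ennreal (\<bar>a t\<bar> * P + \<bar>b t\<bar>)))
          (\<lambda>k. (1 - w k) * (C * w k) ^ k)"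
    and "\<And>n. n \<ge> 1 \<Longrightarrow> q n \<in> {0<..<1}"
    and "q \<longlonglongrightarrow> 1"
    and "(INF n\<in>{1..}. q n) > 0"
  shows "\<exists>x. full_solution \<tau> \<sigma> a b q r f x \<and> bounded (range x)"
proof -
  have C: "0 < C" "C < 1"
    using assms(5) by auto
  obtain D k0 where D: "0 < D" and k0: "1 \<le> k0" and
    bigo: "\<And>k. k0 \<le> k \<Longrightarrow>
      (\<Sum>\<^sub>\<infinity>s\<in>{k..}. ennreal \<bar>1 / r s\<bar> * (\<Sum>\<^sub>\<infinity>t\<in>{s..}. ennreal (\<bar>a t\<bar> * P + \<bar>b t\<bar>)))
        \<le> ennreal (D * ((1 - w k) * (C * w k) ^ k))"
    using assms(9) unfolding ennreal_bigo_def by blast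
  have le: "(\<Sum>\<^sub>\<infinity>s\<in>{k..}. ennreal \<bar>1 / r s\<bar> * (\<Sum>\<^sub>\<infinity>t\<in>{s..}. ennreal (\<bar>a t\<bar> * P + \<bar>b t\<bar>)))
        \<le> ennreal (D * C ^ k)" if "k0 \<le> k" for k
  proof -
    have w: "0 < w k" "w k < 1"
      using assms(7)[of k] k0 that by auto
    have "(C * w k) ^ k \<le> C ^ k"
      using C w by (intro power_mono) (auto simp: mult_le_cancel_left1)
    then have "(1 - w k) * (C * w k) ^ k \<le> 1 * C ^ k"
      using C w by (intro mult_mono) auto
    then have "ennreal (D * ((1 - w k) * (C * w k) ^ k)) \<le> ennreal (D * C ^ k)"
      using D by (intro ennreal_leI mult_left_mono) auto
    with bigo[OF that] show ?thesis
      by (rule order_trans)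
  qed
  have P: "0 \<le> P"
    using assms(4)[of 0] by linarith
  have nonneg: "0 \<le> \<bar>a t\<bar> * P + \<bar>b t\<bar>" "0 \<le> D * C ^ k" for t k
    using P C D by auto
  have r0: "r s \<noteq> 0" if "k0 \<le> s" for s
    using assms(2) that k0 by simp
  have maj: "iterated_majorant r (\<lambda>t. \<bar>a t\<bar> * P + \<bar>b t\<bar>) k0"
    using nonneg(1) r0 nonneg(2) le by (rule iterated_majorant_of_ennreal(1))
  have decay: "iterated_tail (\<lambda>s. \<bar>r s\<bar>) (\<lambda>t. \<bar>a t\<bar> * P + \<bar>b t\<bar>) k \<le> D * C ^ k"
    if "k0 \<le> k" for k
    using nonneg(1) r0 nonneg(2) le that by (rule iterated_majorant_of_ennreal(2))
  interpret iterated_majorant r "\<lambda>t. \<bar>a t\<bar> * P + \<bar>b t\<bar>" k0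
    by (rule maj)
  obtain x N where x: "bounded (range x)" and N: "k0 \<le> N"
    and tail: "\<And>n. N \<le> n \<Longrightarrow> x n + q n * x (n - \<tau>) = iterated_tail r (forcing \<sigma> a b f x) n"
    using assms(1,3,4) C assms(11) maj D decay by (rule eventual_solution) (assumption, rule that)
  have forcing_le: "\<bar>forcing \<sigma> a b f x t\<bar> \<le> 1 * (\<bar>a t\<bar> * P + \<bar>b t\<bar>)" for t
    using abs_forcing_le[OF assms(4)] by simp
  have eventually_solves: "solves_at \<tau> \<sigma> a b q r f x n" if "\<tau> + N \<le> n" for n
  proof -
    have "forward_diff (\<lambda>m. r m * forward_diff (iterated_tail r (forcing \<sigma> a b f x)) m) n
        = forcing \<sigma> a b f x n"
      by (rule iterated_tail_solves[OF _ forcing_le]) (use that N r0 in auto)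
    then show ?thesis
      using that by (simp add: solves_at_def forward_diff_def tail)
  qed
  have "r n \<noteq> 0" "q n \<noteq> 0" if "\<tau> \<le> n" for n
    using assms(1) assms(2)[of n] assms(10)[of n] that by auto
  then have "\<exists>x. (\<forall>n\<ge>\<tau>. solves_at \<tau> \<sigma> a b q r f x n) \<and> bounded (range x)"
    using eventually_solves x by (rule extend_solution_backwards[OF assms(1)])
  then show ?thesis
    using assms(1) by (simp add: full_solution_def solves_at_def forcing_def)
qed

end
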